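(* Let $A$ be a $C^*$-algebra, let $\mathcal{M}$ be a Hilbert $A$-module, and let $T:\mathcal{M}\to\mathcal{M}$ be an injective bounded module map. The following conditions are equivalent: (i) $T$ is $C^*$-conformal; (ii) $T=\lambda U$ for some non-zero positive $\lambda\in\mathbb{R}$ and some isometric module operator $U$ on $\mathcal{M}$.
   Context: $C^*$-algebras are not assumed unital. A Hilbert $A$-module $\mathcal{M}$ is a left $A$-module (with compatible complex linear structure) equipped with an $A$-valued inner product $\langle\cdot,\cdot\rangle:\mathcal{M}\times\mathcal{M}\to A$ that is $A$-linear in the first variable, satisfies $\langle x,y\rangle=\langle y,x\rangle^*$ and $\langle x,x\rangle\ge 0$ with equality iff $x=0$, and such that $\mathcal{M}$ is complete in the norm $\|x\|=\|\langle x,x\rangle\|^{1/2}$. A bounded module map is a bounded $A$-linear (and complex linear) map; an isometric module operator $U$ on $\mathcal{M}$ is a module map $U:\mathcal{M}\to\mathcal{M}$ with $\|Ux\|=\|x\|$ for all $x\in\mathcal{M}$ (not necessarily surjective). An injective bounded module map $T$ on $\mathcal{M}$ is $C^*$-conformal if \[ \frac{\langle Tx,Ty\rangle}{\|Tx\|\,\|Ty\|}=\frac{\langle x,y\rangle}{\|x\|\,\|y\|} \] holds (as an identity in $A$) for all non-zero $x,y\in\mathcal{M}$. *)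

theory Defs
  imports "HOL-Analysis.Analysis"
begin

class complex_vector = real_vector +
  fixes scaleC :: "complex \<Rightarrow> 'a \<Rightarrow> 'a" (infixr "*\<^sub>C" 75)
  assumes scaleC_add_right: "c *\<^sub>C (x + y) = c *\<^sub>C x + c *\<^sub>C y"
    and scaleC_add_left: "(c + d) *\<^sub>C x = c *\<^sub>C x + d *\<^sub>C x"
    and scaleC_scaleC: "c *\<^sub>C (d *\<^sub>C x) = (c * d) *\<^sub>C x"
    and scaleC_of_real: "complex_of_real r *\<^sub>C x = r *\<^sub>R x"

class complex_banach = complex_vector + banach +
  assumes norm_scaleC: "norm (c *\<^sub>C x) = cmod c * norm x"

text \<open>No unit is assumed; the zero algebra is allowed.\<close>

class cstar_algebra = complex_banach + real_normed_algebra +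
  fixes adj :: "'a \<Rightarrow> 'a"
  assumes scaleC_mult_left: "(c *\<^sub>C a) * b = c *\<^sub>C (a * b)"
    and scaleC_mult_right: "a * (c *\<^sub>C b) = c *\<^sub>C (a * b)"
    and adj_adj: "adj (adj a) = a"
    and adj_add: "adj (a + b) = adj a + adj b"
    and adj_scaleC: "adj (c *\<^sub>C a) = cnj c *\<^sub>C adj a"
    and adj_mult: "adj (a * b) = adj b * adj a"
    and cstar_identity: "norm (adj a * a) = (norm a)\<^sup>2"

text \<open>
  The pair (a, s) stands for a + s1 in the unitization of the algebra. The spectrum is always
  taken in the unitization, so it contains 0 for every element; for a unital algebra it is the
  usual spectrum together with 0, which makes no difference to positivity.
\<close>

fun unitization_mult ::
    "'a::cstar_algebra \<times> complex \<Rightarrow> 'a \<times> complex \<Rightarrow> 'a \<times> complex" where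
  "unitization_mult (a, s) (b, t) = (a * b + s *\<^sub>C b + t *\<^sub>C a, s * t)"

definition unitization_invertible :: "'a::cstar_algebra \<times> complex \<Rightarrow> bool" where
  "unitization_invertible u \<longleftrightarrow>
     (\<exists>v. unitization_mult u v = (0, 1) \<and> unitization_mult v u = (0, 1))"

definition spectrum :: "'a::cstar_algebra \<Rightarrow> complex set" where
  "spectrum a = {z. \<not> unitization_invertible (a, - z)}"

definition positive :: "'a::cstar_algebra \<Rightarrow> bool" where
  "positive a \<longleftrightarrow> adj a = a \<and> spectrum a \<subseteq> complex_of_real ` {0..}"

text \<open>
  Completeness of the module is part of the class \<open>complex_banach\<close>; the axiom \<open>norm_eq_sqrt_ip\<close>
  says that the norm of that class is the one induced by the inner product.
\<close>

locale hilbert_module =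
  fixes act :: "'a::cstar_algebra \<Rightarrow> 'm::complex_banach \<Rightarrow> 'm"
    and ip :: "'m \<Rightarrow> 'm \<Rightarrow> 'a"
  assumes act_add_left: "act (a + b) x = act a x + act b x"
    and act_add_right: "act a (x + y) = act a x + act a y"
    and act_mult: "act (a * b) x = act a (act b x)"
    and act_scaleC_left: "act (c *\<^sub>C a) x = c *\<^sub>C act a x"
    and act_scaleC_right: "act a (c *\<^sub>C x) = c *\<^sub>C act a x"
    and ip_add_left: "ip (x + y) z = ip x z + ip y z"
    and ip_scaleC_left: "ip (c *\<^sub>C x) y = c *\<^sub>C ip x y"
    and ip_act_left: "ip (act a x) y = a * ip x y"
    and ip_adj: "ip x y = adj (ip y x)"
    and ip_positive: "positive (ip x x)"
    and ip_eq_zero_iff: "ip x x = 0 \<longleftrightarrow> x = 0"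
    and norm_eq_sqrt_ip: "norm x = sqrt (norm (ip x x))"

definition module_map ::
    "('a::cstar_algebra \<Rightarrow> 'm::complex_banach \<Rightarrow> 'm) \<Rightarrow> ('m \<Rightarrow> 'm) \<Rightarrow> bool" where
  "module_map act T \<longleftrightarrow>
     (\<forall>x y. T (x + y) = T x + T y) \<and>
     (\<forall>c x. T (c *\<^sub>C x) = c *\<^sub>C T x) \<and>
     (\<forall>a x. T (act a x) = act a (T x))"

definition bounded_module_map ::
    "('a::cstar_algebra \<Rightarrow> 'm::complex_banach \<Rightarrow> 'm) \<Rightarrow> ('m \<Rightarrow> 'm) \<Rightarrow> bool" where
  "bounded_module_map act T \<longleftrightarrow> module_map act T \<and> (\<exists>K. \<forall>x. norm (T x) \<le> norm x * K)"

definition isometric_module_operator ::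
    "('a::cstar_algebra \<Rightarrow> 'm::complex_banach \<Rightarrow> 'm) \<Rightarrow> ('m \<Rightarrow> 'm) \<Rightarrow> bool" where
  "isometric_module_operator act U \<longleftrightarrow> module_map act U \<and> (\<forall>x. norm (U x) = norm x)"

definition cstar_conformal ::
    "('a::cstar_algebra \<Rightarrow> 'm::complex_banach \<Rightarrow> 'm) \<Rightarrow> ('m \<Rightarrow> 'm \<Rightarrow> 'a) \<Rightarrow> ('m \<Rightarrow> 'm) \<Rightarrow> bool" where
  "cstar_conformal act ip T \<longleftrightarrow>
     bounded_module_map act T \<and> inj T \<and>
     (\<forall>x y. x \<noteq> 0 \<longrightarrow> y \<noteq> 0 \<longrightarrow>
        ip (T x) (T y) /\<^sub>R (norm (T x) * norm (T y)) = ip x y /\<^sub>R (norm x * norm y))"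

end

theory Submission imports Defs begin

text \<open>
  A conformal T satisfies (Tx, Ty) = f x f y (x, y), where f x is the ratio of the norms of Tx and x.
  Additivity of T gives (f (x + y) - f x) x + (f (x + y) - f y) y = 0, so f is constant
  on independent vectors, hence on all non-zero vectors.

  Conversely, let U be isometric, p = (x, x) and q = (Ux, Ux). Letting the unitization act on the
  module shows that b p b and b q b have the same norm for every self-adjoint b in the unitization.
  For e > 0 take b to be the square root of e / (q + e). Then b q b = e (1 - b^2) has norm less
  than e, hence so has b p b, and therefore b (p - q - e) b = b p b - e is invertible by the
  Neumann series. By symmetry the self-adjoint element p - q has spectrum {0}, so it vanishes,
  because the norm of a self-adjoint element is its spectral radius. Polarization finishes the proof.

  The spectral radius statement is proved without Gelfand's formula: if 1 - z a were invertible for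
  all z in the closed unit disc, averaging the resolvent over the roots of unity of order 2^k
  would give the inverse of 1 - (z a)^(2^k), and comparing the circles of radius r < 1 and 1
  would contradict norm (a^(2^k)) = 1.
\<close>

subsection \<open>The unitization as a C*-algebra\<close>

lemma scaleC_zero_left [simp]: "0 *\<^sub>C (x::'a::complex_vector) = 0"
  using scaleC_of_real[of 0 x] by simp

lemma scaleC_zero_right [simp]: "c *\<^sub>C (0::'a::complex_vector) = 0"
  using scaleC_add_right[of c 0 0] by simp

lemma scaleC_one [simp]: "1 *\<^sub>C (x::'a::complex_vector) = x"
  using scaleC_of_real[of 1 x] by simp

lemma scaleC_minus_right: "c *\<^sub>C (- x) = - (c *\<^sub>C (x::'a::complex_vector))"
  by (metis add.right_inverse add_eq_0_iff scaleC_add_right scaleC_zero_right)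

lemma scaleC_minus_left: "(- c) *\<^sub>C x = - (c *\<^sub>C (x::'a::complex_vector))"
  by (metis add.right_inverse add_eq_0_iff scaleC_add_left scaleC_zero_left)

lemma scaleC_diff_right: "c *\<^sub>C (x - y) = c *\<^sub>C x - c *\<^sub>C (y::'a::complex_vector)"
  using scaleC_add_right[of c x "- y"] by (simp add: scaleC_minus_right)

lemma scaleC_diff_left: "(c - d) *\<^sub>C x = c *\<^sub>C x - d *\<^sub>C (x::'a::complex_vector)"
  using scaleC_add_left[of c "- d" x] by (simp add: scaleC_minus_left)

lemma scaleC_scaleR: "c *\<^sub>C (r *\<^sub>R x) = r *\<^sub>R (c *\<^sub>C (x::'a::complex_vector))"
  by (metis mult.commute scaleC_of_real scaleC_scaleC)

lemma adj_zero [simp]: "adj (0::'a::cstar_algebra) = 0"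
  using adj_add[of "0::'a" 0] by simp

lemma adj_minus: "adj (- a) = - adj (a::'a::cstar_algebra)"
  by (metis add.right_inverse add_eq_0_iff adj_add adj_zero)

lemma adj_diff: "adj (a - b) = adj a - adj (b::'a::cstar_algebra)"
  using adj_add[of a "- b"] by (simp add: adj_minus)

lemma adj_scaleR: "adj (r *\<^sub>R a) = r *\<^sub>R adj (a::'a::cstar_algebra)"
  by (metis adj_scaleC complex_cnj_complex_of_real scaleC_of_real)

text \<open>The C*-identity and submultiplicativity bound \<open>(norm b)^2\<close> by
  \<open>norm (adj b) * norm b\<close>; using this for \<open>a\<close> and for \<open>adj a\<close>
  gives both inequalities.\<close>

lemma norm_adj [simp]: "norm (adj a) = norm (a::'a::cstar_algebra)"
proof -
  have le: "norm b \<le> norm (adj b)" for b :: 'a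
  proof (cases "b = 0")
    case False
    have "norm b * norm b \<le> norm (adj b) * norm b"
      using norm_mult_ineq[of "adj b" b] by (simp add: cstar_identity power2_eq_square)
    then show ?thesis using False by simp
  qed simp
  show ?thesis using le[of a] le[of "adj a"] by (simp add: adj_adj)
qed

lemma bounded_linear_adj: "bounded_linear (adj :: 'a \<Rightarrow> 'a::cstar_algebra)"
  by (rule bounded_linear_intro[where K=1]) (simp_all add: adj_add adj_scaleR)

text \<open>A type of its own, since pairs already carry the Euclidean product norm and an instance
  with a different norm is wanted here.\<close>

datatype 'a unitization = Unitization (alg_part: 'a) (scalar_part: complex)

lemma unitization_eqI:
  "alg_part u = alg_part v \<Longrightarrow> scalar_part u = scalar_part v \<Longrightarrow> u = v"
  by (cases u; cases v) simp

abbreviation embed :: "'a::cstar_algebra \<Rightarrow> 'a unitization" where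
  "embed a \<equiv> Unitization a 0"

text \<open>The algebra is an ideal of its unitization; the operator norm of left multiplication on
  this ideal is the source of the C*-norm.\<close>

definition left_act :: "'a::cstar_algebra unitization \<Rightarrow> 'a \<Rightarrow> 'a" where
  "left_act u b = alg_part u * b + scalar_part u *\<^sub>C b"

lemma bounded_linear_left_act: "bounded_linear (left_act u)"
proof (rule bounded_linear_intro[where K="norm (alg_part u) + cmod (scalar_part u)"])
  show "norm (left_act u b) \<le> norm b * (norm (alg_part u) + cmod (scalar_part u))" for b
    using norm_triangle_ineq[of "alg_part u * b" "scalar_part u *\<^sub>C b"]
      norm_mult_ineq[of "alg_part u" b]
    unfolding left_act_def by (simp add: norm_scaleC algebra_simps)
qed (simp_all add: left_act_def algebra_simps scaleC_add_right scaleC_scaleR)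

lemma norm_left_act_le: "norm (left_act u b) \<le> onorm (left_act u) * norm b"
  by (rule onorm[OF bounded_linear_left_act])

lemma onorm_left_act_le:
  "onorm (left_act u) \<le> norm (alg_part u) + cmod (scalar_part u)"
proof (rule onorm_bound)
  show "norm (left_act u b) \<le> (norm (alg_part u) + cmod (scalar_part u)) * norm b" for b
    using norm_triangle_ineq[of "alg_part u * b" "scalar_part u *\<^sub>C b"]
      norm_mult_ineq[of "alg_part u" b]
    unfolding left_act_def by (simp add: norm_scaleC algebra_simps)
qed simp

text \<open>Testing the operator on \<open>adj a\<close> gives the lower bound, since
  \<open>norm (a * adj a)\<close> is the square of \<open>norm a\<close>.\<close>

lemma onorm_left_act_embed: "onorm (left_act (embed a)) = norm a"
proof (rule antisym)
  show "onorm (left_act (embed a)) \<le> norm a" using onorm_left_act_le[of "embed a"] by simp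
  show "norm a \<le> onorm (left_act (embed a))"
  proof (cases "a = 0")
    case True
    then show ?thesis by (simp add: onorm_pos_le bounded_linear_left_act)
  next
    case False
    have "norm a * norm a \<le> onorm (left_act (embed a)) * norm a"
      using norm_left_act_le[of "embed a" "adj a"] cstar_identity[of "adj a"]
      by (simp add: left_act_def adj_adj power2_eq_square)
    then show ?thesis using False by simp
  qed
qed

section \<open>Ring structure, norm and involution of the unitization\<close>

instantiation unitization :: (cstar_algebra) ring_1
begin
definition "0 = Unitization 0 0"
definition "1 = Unitization 0 1"
definition "u + v = Unitization (alg_part u + alg_part v) (scalar_part u + scalar_part v)"
definition "- u = Unitization (- alg_part u) (- scalar_part u)"
definition "u - v = Unitization (alg_part u - alg_part v) (scalar_part u - scalar_part v)"
definition "u * v = Unitization (alg_part u * alg_part v + scalar_part u *\<^sub>C alg_part v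
  + scalar_part v *\<^sub>C alg_part u) (scalar_part u * scalar_part v)"
lemmas unitization_ring_defs = zero_unitization_def one_unitization_def plus_unitization_def
  uminus_unitization_def minus_unitization_def times_unitization_def
instance
  by standard (auto simp: unitization_ring_defs algebra_simps scaleC_add_left
    scaleC_add_right scaleC_scaleC scaleC_mult_left scaleC_mult_right)
end

instantiation unitization :: (cstar_algebra) complex_vector
begin
definition "r *\<^sub>R u = Unitization (r *\<^sub>R alg_part u) (r *\<^sub>R scalar_part u)"
definition "c *\<^sub>C u = Unitization (c *\<^sub>C alg_part u) (c * scalar_part u)"
instance
  by standard (auto simp: unitization_ring_defs scaleR_unitization_def scaleC_unitization_def
    algebra_simps scaleC_add_left scaleC_add_right scaleC_scaleC scaleC_of_real
    scaleR_conv_of_real)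
end

text \<open>Subtracting multiplication by the scalar part from \<open>left_act u\<close> leaves left
  multiplication by the algebra part, whose operator norm is the norm of that part.\<close>

lemma onorm_left_act_embed_le:
  "norm (alg_part u) \<le> onorm (left_act u) + cmod (scalar_part u)"
proof -
  have "onorm (left_act (embed (alg_part u))) \<le> onorm (left_act u) + cmod (scalar_part u)"
  proof (rule onorm_bound)
    fix b
    have "left_act (embed (alg_part u)) b = left_act u b - scalar_part u *\<^sub>C b"
      by (simp add: left_act_def)
    then show "norm (left_act (embed (alg_part u)) b)
        \<le> (onorm (left_act u) + cmod (scalar_part u)) * norm b"
      using norm_triangle_ineq4[of "left_act u b" "scalar_part u *\<^sub>C b"] norm_left_act_le[of u b]
      unfolding norm_scaleC distrib_right by simp
  qed (simp add: onorm_pos_le bounded_linear_left_act)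
  then show ?thesis by (simp add: onorm_left_act_embed)
qed

instantiation unitization :: (cstar_algebra) real_normed_vector
begin
text \<open>If the algebra already has a unit, the operator norm alone is only a seminorm on the
  unitization; the scalar part in the maximum makes it a norm in every case.\<close>
definition "norm u = max (onorm (left_act u)) (cmod (scalar_part u))"
definition "dist u v = norm (u - v :: 'a unitization)"
definition "sgn u = u /\<^sub>R norm (u :: 'a unitization)"
definition "uniformity =
  (INF e\<in>{0<..}. principal {(u, v :: 'a unitization). dist u v < e})"
definition "open S =
  (\<forall>u\<in>S. \<forall>\<^sub>F (u', v) in uniformity. u' = u \<longrightarrow> v \<in> (S :: 'a unitization set))"
instance
proof
  fix u v :: "'a unitization" and r :: real
  show "(norm u = 0) = (u = 0)"
  proof
    assume "norm u = 0"
    then have s: "scalar_part u = 0" and "onorm (left_act u) \<le> 0"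
      using norm_ge_zero[of "scalar_part u"] unfolding norm_unitization_def
      by (metis max.cobounded2 norm_le_zero_iff, metis max.cobounded1)
    then have "norm (alg_part u) \<le> 0"
      using onorm_left_act_embed_le[of u] unfolding s norm_zero by linarith
    then have "alg_part u = 0" by simp
    then show "u = 0" using s by (intro unitization_eqI) (simp_all add: zero_unitization_def)
  next
    assume "u = 0"
    then show "norm u = 0"
      using onorm_left_act_embed[of "0::'a"] by (simp add: norm_unitization_def zero_unitization_def)
  qed
  have "left_act (u + v) = (\<lambda>b. left_act u b + left_act v b)"
    by (auto simp: left_act_def plus_unitization_def algebra_simps scaleC_add_left)
  then have "onorm (left_act (u + v)) \<le> onorm (left_act u) + onorm (left_act v)"
    using onorm_triangle[OF bounded_linear_left_act bounded_linear_left_act] by metis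
  moreover have "cmod (scalar_part (u + v)) \<le> cmod (scalar_part u) + cmod (scalar_part v)"
    by (simp add: plus_unitization_def norm_triangle_ineq)
  ultimately show "norm (u + v) \<le> norm u + norm v"
    unfolding norm_unitization_def by linarith
  have "left_act (r *\<^sub>R u) = (\<lambda>b. r *\<^sub>R left_act u b)"
    by (auto simp: left_act_def scaleR_unitization_def algebra_simps scaleC_of_real
      scaleR_conv_of_real scaleC_scaleC[symmetric])
  then have "onorm (left_act (r *\<^sub>R u)) = \<bar>r\<bar> * onorm (left_act u)"
    using onorm_scaleR[OF bounded_linear_left_act] by metis
  then show "norm (r *\<^sub>R u) = \<bar>r\<bar> * norm u"
    by (simp add: norm_unitization_def scaleR_unitization_def norm_mult max_mult_distrib_left)
qed (simp_all add: dist_unitization_def sgn_unitization_def uniformity_unitization_def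
      open_unitization_def)
end

lemma left_act_mult: "left_act (u * v) b = left_act u (left_act v b)"
  by (simp add: left_act_def times_unitization_def algebra_simps scaleC_add_right scaleC_scaleC
    scaleC_mult_left scaleC_mult_right)

lemma norm_mult_unitization_le: "norm (u * v) \<le> norm u * norm (v :: 'a::cstar_algebra unitization)"
proof -
  have "left_act (u * v) = left_act u \<circ> left_act v"
    by (auto simp: left_act_mult)
  then have "onorm (left_act (u * v)) \<le> onorm (left_act u) * onorm (left_act v)"
    using onorm_compose[OF bounded_linear_left_act bounded_linear_left_act] by metis
  also have "\<dots> \<le> norm u * norm v"
    by (intro mult_mono) (auto simp: norm_unitization_def onorm_pos_le[OF bounded_linear_left_act]
      intro: le_max_iff_disj[THEN iffD2])
  finally have *: "onorm (left_act (u * v)) \<le> norm u * norm v" .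
  have "cmod (scalar_part (u * v)) = cmod (scalar_part u) * cmod (scalar_part v)"
    by (simp add: times_unitization_def norm_mult)
  also have "\<dots> \<le> norm u * norm v"
    by (intro mult_mono) (auto simp: norm_unitization_def 
      intro: le_max_iff_disj[THEN iffD2])
  finally show ?thesis using * by (simp add: norm_unitization_def[of "u * v"])
qed

instance unitization :: (cstar_algebra) real_normed_algebra_1
proof
  fix u v :: "'a unitization" and r :: real
  show "r *\<^sub>R u * v = r *\<^sub>R (u * v)" "u * r *\<^sub>R v = r *\<^sub>R (u * v)"
    by (auto simp: times_unitization_def scaleR_unitization_def algebra_simps scaleC_scaleR
      scaleC_of_real scaleR_conv_of_real scaleC_scaleC[symmetric])
  show "norm (u * v) \<le> norm u * norm v" by (rule norm_mult_unitization_le)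
  show "norm (1 :: 'a unitization) = 1"
    using onorm_left_act_le[of "1 :: 'a unitization"] by (simp add: norm_unitization_def one_unitization_def)
qed

text \<open>This bound and the next two make the norm equivalent to the sum of the norms of both
  parts, which reduces completeness to that of the algebra and of the complex numbers.\<close>

lemma norm_alg_part_le: "norm (alg_part u) \<le> 2 * norm u"
  using onorm_left_act_embed_le[of u] unfolding norm_unitization_def by linarith

lemma norm_scalar_part_le: "cmod (scalar_part u) \<le> norm u"
  unfolding norm_unitization_def by linarith

lemma norm_unitization_le: "norm u \<le> norm (alg_part u) + cmod (scalar_part u)"
  using onorm_left_act_le[of u] unfolding norm_unitization_def by simp

instance unitization :: (cstar_algebra) banach
proof
  fix X :: "nat \<Rightarrow> 'a unitization"
  assume X: "Cauchy X"
  have "bounded_linear (alg_part :: 'a unitization \<Rightarrow> 'a)"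
    using norm_alg_part_le by (intro bounded_linear_intro[where K=2])
      (simp_all add: plus_unitization_def scaleR_unitization_def mult.commute)
  then obtain a where a: "(\<lambda>n. alg_part (X n)) \<longlonglongrightarrow> a"
    using X bounded_linear.Cauchy Cauchy_convergent_iff convergentD by metis
  have "bounded_linear (scalar_part :: 'a unitization \<Rightarrow> complex)"
    using norm_scalar_part_le by (intro bounded_linear_intro[where K=1])
      (simp_all add: plus_unitization_def scaleR_unitization_def)
  then obtain s where s: "(\<lambda>n. scalar_part (X n)) \<longlonglongrightarrow> s"
    using X bounded_linear.Cauchy Cauchy_convergent_iff convergentD by metis
  have "(\<lambda>n. norm (alg_part (X n) - a) + cmod (scalar_part (X n) - s)) \<longlonglongrightarrow> 0"
    using tendsto_add[OF tendsto_norm_zero[OF a[THEN LIM_zero]] tendsto_norm_zero[OF s[THEN LIM_zero]]]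
    by simp
  then have "(\<lambda>n. X n - Unitization a s) \<longlonglongrightarrow> 0"
  proof (rule Lim_null_comparison[rotated])
    show "\<forall>\<^sub>F n in sequentially. norm (X n - Unitization a s)
        \<le> norm (alg_part (X n) - a) + cmod (scalar_part (X n) - s)"
      using norm_unitization_le[of "X n - Unitization a s" for n]
      by (simp add: minus_unitization_def)
  qed
  then show "convergent X"
    using LIM_zero_cancel convergentI by blast
qed

instantiation unitization :: (cstar_algebra) cstar_algebra
begin
definition "adj u = Unitization (adj (alg_part u)) (cnj (scalar_part u))"
instance
proof
  fix u v :: "'a unitization" and c :: complex
  have "left_act (c *\<^sub>C u) b = c *\<^sub>C left_act u b" for b
    by (simp add: left_act_def scaleC_unitization_def scaleC_add_right scaleC_scaleC scaleC_mult_left)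
  \<comment> \<open>An operator norm depends only on the norms of the values, so complex homogeneity
    follows from real homogeneity with factor \<open>cmod c\<close>.\<close>
  then have "onorm (left_act (c *\<^sub>C u)) = onorm (\<lambda>b. cmod c *\<^sub>R left_act u b)"
    by (simp add: onorm_def norm_scaleC)
  then have "onorm (left_act (c *\<^sub>C u)) = cmod c * onorm (left_act u)"
    using onorm_scaleR[OF bounded_linear_left_act, of "cmod c" u] by simp
  then show "norm (c *\<^sub>C u) = cmod c * norm u"
    by (simp add: norm_unitization_def scaleC_unitization_def norm_mult max_mult_distrib_left)
  show "c *\<^sub>C u * v = c *\<^sub>C (u * v)" "u * c *\<^sub>C v = c *\<^sub>C (u * v)"
    by (simp_all add: times_unitization_def scaleC_unitization_def scaleC_add_right scaleC_scaleC
      scaleC_mult_left scaleC_mult_right mult.commute mult.left_commute)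
  show "adj (adj u) = u" "adj (u + v) = adj u + adj v" "adj (c *\<^sub>C u) = cnj c *\<^sub>C adj u"
    "adj (u * v) = adj v * adj u"
    by (simp_all add: adj_unitization_def times_unitization_def plus_unitization_def
      scaleC_unitization_def adj_add adj_adj adj_mult adj_scaleC add.commute add.left_commute)
  \<comment> \<open>The C*-identity is shown for the operator norm and for the modulus of the scalar
    part separately; the maximum of two non-negative numbers commutes with squaring.\<close>
  define N where "N u = onorm (left_act u)" for u :: "'a unitization"
  have N0: "0 \<le> N u" for u
    unfolding N_def by (rule onorm_pos_le[OF bounded_linear_left_act])
  have Nm: "N (u * v) \<le> N u * N v" for u v
  proof -
    have "left_act (u * v) = left_act u \<circ> left_act v"
      by (auto simp: left_act_mult)
    then show ?thesis
      using onorm_compose[OF bounded_linear_left_act bounded_linear_left_act] unfolding N_def by metis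
  qed
  \<comment> \<open>The C*-identity of the algebra turns the square of
    \<open>norm (left_act u b)\<close> into the norm of
    \<open>adj b * left_act (adj u * u) b\<close>.\<close>
  have N2: "(N u)\<^sup>2 \<le> N (adj u * u)" for u
  proof -
    have "norm (left_act u b) \<le> sqrt (N (adj u * u)) * norm b" for b
    proof -
      have "adj (left_act u b) * left_act u b = adj b * left_act (adj u * u) b"
        unfolding left_act_mult
        by (simp add: left_act_def adj_unitization_def adj_add adj_mult adj_scaleC
          algebra_simps scaleC_mult_left scaleC_mult_right scaleC_add_right scaleC_scaleC)
      then have "(norm (left_act u b))\<^sup>2 \<le> norm (adj b) * norm (left_act (adj u * u) b)"
        using norm_mult_ineq cstar_identity by metis
      also have "\<dots> \<le> norm b * (N (adj u * u) * norm b)"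
        using norm_left_act_le[of "adj u * u" b] by (simp add: mult_left_mono N_def)
      also have "\<dots> = (sqrt (N (adj u * u)) * norm b)\<^sup>2"
        by (simp add: power_mult_distrib N0 power2_eq_square)
      finally show ?thesis
        by (rule power2_le_imp_le) (simp add: N0)
    qed
    then have "N u \<le> sqrt (N (adj u * u))"
      unfolding N_def[of u] by (intro onorm_bound) (simp_all add: N0)
    then show ?thesis
      by (metis N0 power_mono real_sqrt_pow2)
  qed
  \<comment> \<open>By the same cancellation as in \<open>norm_adj\<close>, the involution is
    isometric for \<open>N\<close>.\<close>
  have le: "N u \<le> N (adj u)" for u
  proof (cases "N u = 0")
    case True
    then show ?thesis by (simp add: N0)
  next
    case False
    have "N u * N u \<le> N (adj u) * N u"
      using N2[of u] Nm[of "adj u" u] by (simp add: power2_eq_square)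
    then show ?thesis using False N0[of u] by simp
  qed
  have "N (adj u) \<le> N u"
    using le[of "adj u"] by (simp add: \<open>adj (adj u) = u\<close>)
  then have "N (adj u * u) = (N u)\<^sup>2"
    using N2[of u] Nm[of "adj u" u] mult_right_mono[OF _ N0, of "N (adj u)" "N u" u]
    by (simp add: power2_eq_square)
  moreover have "cmod (scalar_part (adj u * u)) = (cmod (scalar_part u))\<^sup>2"
    by (simp add: times_unitization_def adj_unitization_def norm_mult power2_eq_square)
  moreover have "max (x\<^sup>2) (y\<^sup>2) = (max x y)\<^sup>2" if "0 \<le> x" "0 \<le> y" for x y :: real
    using that by (simp add: max_def)
  ultimately show "norm (adj u * u) = (norm u)\<^sup>2"
    using N0[of u] by (simp add: norm_unitization_def N_def)
qed
end

lemma norm_embed: "norm (embed a) = norm a"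
  by (simp add: norm_unitization_def onorm_left_act_embed onorm_pos_le bounded_linear_left_act)

subsection \<open>Invertibility and the spectral radius\<close>

definition inverses :: "'b::ring_1 \<Rightarrow> 'b \<Rightarrow> bool" where
  "inverses x y \<longleftrightarrow> x * y = 1 \<and> y * x = 1"

definition invertible_element :: "'b::ring_1 \<Rightarrow> bool" where
  "invertible_element x \<longleftrightarrow> (\<exists>y. inverses x y)"

text \<open>A left and a right inverse coincide, so the two may be produced independently.\<close>

lemma invertible_elementI: "x * y = 1 \<Longrightarrow> z * x = 1 \<Longrightarrow> invertible_element x"
  unfolding invertible_element_def inverses_def by (metis mult.assoc mult_1_left mult_1_right)

lemma invertible_element_one [simp]: "invertible_element 1"
  by (rule invertible_elementI[of _ 1 1]) simp_all

lemma invertible_element_mult: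
  "invertible_element x \<Longrightarrow> invertible_element y \<Longrightarrow> invertible_element (x * y)"
  unfolding invertible_element_def inverses_def by (metis mult.assoc mult_1_right)

lemma invertible_element_scaleC:
  fixes x :: "'b::{cstar_algebra, real_normed_algebra_1}"
  assumes "invertible_element x" "c \<noteq> 0"
  shows "invertible_element (c *\<^sub>C x)"
proof -
  from assms(1) obtain y where "inverses x y" unfolding invertible_element_def by blast
  then show ?thesis
    using assms(2) by (intro invertible_elementI[of _ "inverse c *\<^sub>C y" "inverse c *\<^sub>C y"])
      (simp_all add: inverses_def scaleC_mult_left scaleC_mult_right scaleC_scaleC)
qed

lemma invertible_element_scaleC_iff:
  fixes x :: "'b::{cstar_algebra, real_normed_algebra_1}"
  assumes "c \<noteq> 0"
  shows "invertible_element (c *\<^sub>C x) \<longleftrightarrow> invertible_element x"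
  using invertible_element_scaleC[of x c] invertible_element_scaleC[of "c *\<^sub>C x" "inverse c"] assms
  by (auto simp: scaleC_scaleC)

lemma invertible_element_of_mult:
  assumes "invertible_element b" "invertible_element (b * x * b)"
  shows "invertible_element x"
proof -
  from assms(1) obtain c where c: "inverses b c" unfolding invertible_element_def by blast
  then have "invertible_element c" unfolding invertible_element_def inverses_def by blast
  then have "invertible_element (c * (b * x * b) * c)"
    by (intro invertible_element_mult assms)
  moreover have "c * (b * x * b) * c = (c * b) * x * (b * c)" by (simp add: mult.assoc)
  ultimately show ?thesis using c by (simp add: inverses_def)
qed

text \<open>If \<open>c\<close> inverts \<open>b * b\<close>, then \<open>b * c\<close> is a right
  inverse and \<open>c * b\<close> a left inverse of \<open>b\<close>.\<close>

lemma invertible_element_of_square: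
  "invertible_element (b * b) \<Longrightarrow> invertible_element b"
  unfolding invertible_element_def[of "b * b"] inverses_def
  by (metis invertible_elementI mult.assoc)

text \<open>The sum of the Neumann series is obtained as a fixed point: the contractions
  \<open>1 + a * x\<close> and \<open>1 + x * a\<close> have a right and a left inverse of
  \<open>1 - a\<close> as their fixed points.\<close>

lemma invertible_one_minus:
  fixes a :: "'b::{real_normed_algebra_1, banach}"
  assumes "norm a < 1"
  shows "invertible_element (1 - a)"
proof -
  have "\<forall>x y. dist (1 + a * x) (1 + a * y) \<le> norm a * dist x y"
    by (metis add_diff_cancel_left dist_norm norm_mult_ineq right_diff_distrib)
  then obtain x where x: "1 + a * x = x"
    using banach_fix_type[of "norm a" "\<lambda>x. 1 + a * x"] assms by auto
  have "\<forall>x y. dist (1 + x * a) (1 + y * a) \<le> norm a * dist x y"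
    by (metis add_diff_cancel_left dist_norm norm_mult_ineq left_diff_distrib mult.commute)
  then obtain y where y: "1 + y * a = y"
    using banach_fix_type[of "norm a" "\<lambda>x. 1 + x * a"] assms by auto
  show ?thesis
    by (rule invertible_elementI[of _ x y])
      (use x y in \<open>simp_all add: left_diff_distrib right_diff_distrib diff_eq_eq\<close>)
qed

lemma invertible_scalar_minus:
  fixes a :: "'b::{cstar_algebra, real_normed_algebra_1}"
  assumes "norm a < cmod z"
  shows "invertible_element (a - z *\<^sub>C 1)"
proof -
  have z: "z \<noteq> 0" using assms norm_ge_zero[of a] by auto
  have "norm (inverse z *\<^sub>C a) < 1"
    using assms z by (simp add: norm_scaleC norm_divide divide_simps)
  then have "invertible_element ((- z) *\<^sub>C (1 - inverse z *\<^sub>C a))"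
    using z by (intro invertible_element_scaleC invertible_one_minus) simp_all
  also have "(- z) *\<^sub>C (1 - inverse z *\<^sub>C a) = a - z *\<^sub>C 1"
    using z by (simp add: scaleC_diff_right scaleC_scaleC scaleC_minus_left)
  finally show ?thesis .
qed

lemma adj_one [simp]: "adj (1 :: 'b::{cstar_algebra, real_normed_algebra_1}) = 1"
  by (metis adj_adj adj_mult mult_1_left mult_1_right)

lemma selfadjoint_nonreal_invertible:
  fixes a :: "'b::{cstar_algebra, real_normed_algebra_1}"
  assumes a: "adj a = a" and z: "Im z \<noteq> 0"
  shows "invertible_element (a - z *\<^sub>C 1)"
proof -
  \<comment> \<open>Shifting by a large imaginary scalar pushes z outside the norm ball, because
    the norm of a + it grows only like the square root of (norm a)^2 + t^2.\<close>
  define t where "t = (norm a)\<^sup>2 / (2 * Im z)"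
  define w where "w = z + \<i> * complex_of_real t"
  define u where "u = a + (\<i> * complex_of_real t) *\<^sub>C 1"
  have "adj u * u = a * a + (complex_of_real (t\<^sup>2)) *\<^sub>C 1"
    by (simp add: u_def adj_add adj_scaleC a algebra_simps scaleC_mult_left scaleC_mult_right
      scaleC_scaleC scaleC_minus_left scaleC_add_right scaleC_diff_right power2_eq_square)
  then have "(norm u)\<^sup>2 \<le> norm (a * a) + norm (complex_of_real (t\<^sup>2) *\<^sub>C (1::'b))"
    by (metis cstar_identity norm_triangle_ineq)
  also have "\<dots> = (norm a)\<^sup>2 + t\<^sup>2"
    using cstar_identity[of a] a by (simp add: norm_scaleC norm_power)
  \<comment> \<open>The constant \<open>t\<close> makes the cross term \<open>2 * Im z * t\<close>
    equal to the square of \<open>norm a\<close>, so the excess of the right side is the squared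
    modulus of \<open>z\<close>.\<close>
  also have "\<dots> < (Re z)\<^sup>2 + (Im z + t)\<^sup>2"
  proof -
    have "2 * Im z * t = (norm a)\<^sup>2" using z by (simp add: t_def)
    moreover have "(Im z)\<^sup>2 > 0" using z by simp
    ultimately show ?thesis by (simp add: power2_sum add_pos_nonneg add_nonneg_pos)
  qed
  also have "\<dots> = (cmod w)\<^sup>2" by (simp add: w_def cmod_power2)
  finally have "norm u < cmod w" by (rule power2_less_imp_less) simp
  then have "invertible_element (u - w *\<^sub>C 1)" by (rule invertible_scalar_minus)
  moreover have "u - w *\<^sub>C 1 = a - z *\<^sub>C 1" by (simp add: u_def w_def scaleC_add_left)
  ultimately show ?thesis by simp
qed

section \<open>The resolvent on the unit disc, and the norm as spectral radius\<close>

lemma continuous_on_resolvent: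
  fixes a :: "'b::{cstar_algebra, real_normed_algebra_1}"
  assumes R: "\<And>z. z \<in> S \<Longrightarrow> inverses (1 - z *\<^sub>C a) (R z)"
  shows "continuous_on S R"
proof (rule continuous_on_iff[THEN iffD2], intro ballI allI impI)
  fix w and e :: real assume w: "w \<in> S" and e: "0 < e"
  define C where "C = norm a * norm (R w) + 1"
  define D where "D = norm (R w) + 1"
  have C: "C > 0" "D > 0" by (simp_all add: C_def D_def add_nonneg_pos)
  \<comment> \<open>The first bound in the minimum yields
    \<open>norm (R z) <= 2 * norm (R w)\<close>; the second then makes the difference smaller than
    \<open>e\<close>.\<close>
  define d where "d = min (1 / (2 * C)) (e / (2 * C * D))"
  have d: "d > 0" using C e by (simp add: d_def)
  have "dist (R z) (R w) < e" if z: "z \<in> S" "dist z w < d" for z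
  proof -
    \<comment> \<open>This is the resolvent identity, obtained by inserting \<open>1 - w a\<close>
      and \<open>1 - z a\<close> next to their inverses.\<close>
    have "R z - R w = R z * ((1 - w *\<^sub>C a) * R w) - R z * (1 - z *\<^sub>C a) * R w"
      using R[OF z(1)] R[OF w] by (simp add: inverses_def)
    also have "\<dots> = R z * ((z - w) *\<^sub>C a) * R w"
      by (simp add: algebra_simps scaleC_diff_left)
    finally have "norm (R z - R w) \<le> norm (R z) * norm ((z - w) *\<^sub>C a) * norm (R w)"
      using norm_mult_ineq[of "R z * ((z - w) *\<^sub>C a)" "R w"]
        mult_right_mono[OF norm_mult_ineq norm_ge_zero] order_trans by force
    also have "\<dots> \<le> norm (R z) * (cmod (z - w) * C)"
      unfolding norm_scaleC mult.assoc by (intro mult_left_mono) (simp_all add: C_def)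
    finally have 1: "norm (R z - R w) \<le> norm (R z) * (cmod (z - w) * C)" .
    have "cmod (z - w) * C \<le> 1 / 2"
      using z(2) C by (simp add: d_def dist_norm field_simps)
    then have "norm (R z - R w) \<le> norm (R z) * (1 / 2)"
      using 1 mult_left_mono[OF _ norm_ge_zero] order_trans by blast
    then have "norm (R z) \<le> 2 * norm (R w)"
      using norm_triangle_sub[of "R z" "R w"] by linarith
    then have "norm (R z) < 2 * D" by (simp add: D_def)
    then have "norm (R z - R w) \<le> 2 * D * (cmod (z - w) * C)"
      using 1 C by (intro order_trans[OF 1] mult_right_mono) simp_all
    also have "\<dots> < e"
      using z(2) C by (simp add: d_def dist_norm field_simps)
    finally show ?thesis by (simp add: dist_norm)
  qed
  then show "\<exists>d>0. \<forall>z\<in>S. dist z w < d \<longrightarrow> dist (R z) (R w) < e" using d by blast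
qed

lemma scaleC_power:
  fixes a :: "'b::{cstar_algebra, real_normed_algebra_1}"
  shows "(c *\<^sub>C a) ^ n = (c ^ n) *\<^sub>C (a ^ n)"
  by (induction n) (simp_all add: scaleC_mult_left scaleC_mult_right scaleC_scaleC mult.commute)

text \<open>Partial fractions: multiplying \<open>x\<close> and \<open>y\<close> by
  \<open>1 - b * b\<close> gives \<open>1 + b\<close> and \<open>1 - b\<close>, which sum to
  2.\<close>

lemma inverses_one_minus_square:
  fixes b :: "'b::real_algebra_1"
  assumes "inverses (1 - b) x" "inverses (1 + b) y"
  shows "inverses (1 - b * b) ((1 / 2) *\<^sub>R (x + y))"
proof -
  have "(1 - b * b) * x = 1 + b"
  proof -
    have "1 - b * b = (1 + b) * (1 - b)" by (simp add: algebra_simps)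
    then show ?thesis using assms(1) by (simp add: inverses_def mult.assoc)
  qed
  moreover have "(1 - b * b) * y = 1 - b"
  proof -
    have "1 - b * b = (1 - b) * (1 + b)" by (simp add: algebra_simps)
    then show ?thesis using assms(2) by (simp add: inverses_def mult.assoc)
  qed
  moreover have "x * (1 - b * b) = 1 + b"
  proof -
    have "1 - b * b = (1 - b) * (1 + b)" by (simp add: algebra_simps)
    then show ?thesis using assms(1) by (simp add: inverses_def mult.assoc[symmetric])
  qed
  moreover have "y * (1 - b * b) = 1 - b"
  proof -
    have "1 - b * b = (1 + b) * (1 - b)" by (simp add: algebra_simps)
    then show ?thesis using assms(2) by (simp add: inverses_def mult.assoc[symmetric])
  qed
  ultimately show ?thesis
    by (simp add: inverses_def distrib_left distrib_right scaleR_2[symmetric] flip: scaleR_add_right)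
qed

text \<open>Each inverse for \<open>k + 1\<close> is the average of two inverses for
  \<open>k\<close>, so the bound \<open>e\<close> survives unchanged for all exponents
  \<open>2^k\<close>.\<close>

lemma resolvent_power_close:
  fixes a :: "'b::{cstar_algebra, real_normed_algebra_1}"
  assumes R: "\<And>z. cmod z \<le> 1 \<Longrightarrow> inverses (1 - z *\<^sub>C a) (R z)"
    and r: "0 \<le> r" "r \<le> 1"
    and close: "\<And>z. cmod z = 1 \<Longrightarrow> norm (R (of_real r * z) - R z) \<le> e"
  shows "cmod z = 1 \<Longrightarrow> \<exists>x y. inverses (1 - ((of_real r * z) *\<^sub>C a) ^ (2 ^ k)) x \<and>
    inverses (1 - (z *\<^sub>C a) ^ (2 ^ k)) y \<and> norm (x - y) \<le> e"
proof (induction k arbitrary: z)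
  case 0
  have "cmod (of_real r * z) \<le> 1" using 0 r by (simp add: norm_mult)
  then have "inverses (1 - ((of_real r * z) *\<^sub>C a) ^ (2 ^ 0)) (R (of_real r * z))"
    using R by (metis power_0 power_one_right)
  moreover have "inverses (1 - (z *\<^sub>C a) ^ (2 ^ 0)) (R z)"
    using R[of z] 0 by simp
  ultimately show ?case using close[OF 0] by blast
next
  case (Suc k)
  \<comment> \<open>Rotating z by a root of -1 of order 2^k flips the sign of (z a)^(2^k), and
    1/(1 - b) + 1/(1 + b) = 2/(1 - b^2).\<close>
  define w where "w = z * cis (pi / 2 ^ k)"
  have w: "cmod w = 1" by (simp add: w_def norm_mult Suc.prems)
  have "cis (pi / 2 ^ k) ^ (2 ^ k) = -1"
    by (simp add: Complex.DeMoivre)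
  then have flip: "((c * w) *\<^sub>C a) ^ (2 ^ k) = - (((c * z) *\<^sub>C a) ^ (2 ^ k))" for c
    by (simp add: scaleC_power w_def power_mult_distrib scaleC_minus_left)
  obtain x y where xy: "inverses (1 - ((of_real r * z) *\<^sub>C a) ^ (2 ^ k)) x"
    "inverses (1 - (z *\<^sub>C a) ^ (2 ^ k)) y" "norm (x - y) \<le> e"
    using Suc by blast
  obtain x' y' where xy': "inverses (1 - ((of_real r * w) *\<^sub>C a) ^ (2 ^ k)) x'"
    "inverses (1 - (w *\<^sub>C a) ^ (2 ^ k)) y'" "norm (x' - y') \<le> e"
    using Suc.IH[OF w] by blast
  have sq: "b ^ (2 ^ Suc k) = b ^ 2 ^ k * b ^ 2 ^ k" for b :: 'b
    by (simp add: mult_2 flip: power_add)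
  have "inverses (1 - ((of_real r * z) *\<^sub>C a) ^ (2 ^ Suc k)) ((1 / 2) *\<^sub>R (x + x'))"
    unfolding sq using xy(1) xy'(1) flip[of "of_real r"] by (intro inverses_one_minus_square) simp_all
  moreover have "inverses (1 - (z *\<^sub>C a) ^ (2 ^ Suc k)) ((1 / 2) *\<^sub>R (y + y'))"
    unfolding sq using xy(2) xy'(2) flip[of 1] by (intro inverses_one_minus_square) simp_all
  moreover have "norm ((1 / 2) *\<^sub>R (x + x') - (1 / 2) *\<^sub>R (y + y')) \<le> e"
  proof -
    have "(1 / 2) *\<^sub>R (x + x') - (1 / 2) *\<^sub>R (y + y') = (1 / 2) *\<^sub>R ((x - y) + (x' - y'))"
      by (simp add: algebra_simps)
    then show ?thesis
      using norm_triangle_ineq[of "x - y" "x' - y'"] xy(3) xy'(3) by simp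
  qed
  ultimately show ?case by blast
qed

lemma unit_norm_resolvent:
  fixes a :: "'b::{cstar_algebra, real_normed_algebra_1}"
  assumes pow: "\<And>k. norm (a ^ (2 ^ k)) = 1"
  shows "\<exists>z. cmod z \<le> 1 \<and> \<not> invertible_element (1 - z *\<^sub>C a)"
proof (rule ccontr)
  assume "\<not> ?thesis"
  then have "\<forall>z. cmod z \<le> 1 \<longrightarrow> (\<exists>y. inverses (1 - z *\<^sub>C a) y)"
    unfolding invertible_element_def by blast
  then obtain R where R: "\<And>z. cmod z \<le> 1 \<Longrightarrow> inverses (1 - z *\<^sub>C a) (R z)"
    by metis
  \<comment> \<open>Compactness makes the continuity uniform, so a single radius
    \<open>r < 1\<close> serves the whole unit circle.\<close>
  have "continuous_on (cball 0 1) R"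
    using R by (intro continuous_on_resolvent) auto
  then have "uniformly_continuous_on (cball 0 1) R"
    by (rule compact_uniformly_continuous) simp
  then obtain d where "d > 0"
    "\<forall>z\<in>cball 0 1. \<forall>w\<in>cball 0 1. dist w z < d \<longrightarrow> dist (R w) (R z) < 1 / 16"
    unfolding uniformly_continuous_on_def by (meson zero_less_divide_1_iff zero_less_numeral)
  then have d: "d > 0"
    "\<And>z w. cmod z \<le> 1 \<Longrightarrow> cmod w \<le> 1 \<Longrightarrow> dist w z < d \<Longrightarrow> dist (R w) (R z) < 1 / 16"
    by auto
  \<comment> \<open>The maximum with 0 keeps the radius non-negative when \<open>d\<close> exceeds
    2.\<close>
  define r where "r = max 0 (1 - d / 2)"
  have r: "0 \<le> r" "r < 1" "1 - r < d" using d(1) by (auto simp: r_def)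
  have close: "norm (R (of_real r * z) - R z) \<le> 1 / 16" if "cmod z = 1" for z
  proof -
    have "of_real r * z - z = of_real (r - 1) * z"
      by (simp add: algebra_simps)
    then have "dist (of_real r * z) z = 1 - r"
      using r that by (simp add: dist_norm norm_mult del: of_real_diff)
    then show ?thesis
      using d(2)[of z "of_real r * z"] r that by (simp add: norm_mult dist_norm)
  qed
  \<comment> \<open>With \<open>norm u < 1/32\<close>, the inverse \<open>x\<close> lies within 1/16
    of 1, hence \<open>y\<close> within 1/8; this suffices because the last estimate loses only a
    factor 2.\<close>
  obtain n where n: "r ^ n < 1 / 32" using real_arch_pow_inv[of "1/32" r] r by auto
  have "r ^ (2 ^ n) \<le> r ^ n" using r by (intro power_decreasing) simp_all
  with n have rn: "r ^ (2 ^ n) < 1 / 32" by simp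
  have one: "cmod 1 = 1" by simp
  obtain x y where x: "inverses (1 - ((of_real r * 1) *\<^sub>C a) ^ (2 ^ n)) x"
    and y: "inverses (1 - (1 *\<^sub>C a) ^ (2 ^ n)) y" and xy: "norm (x - y) \<le> 1 / 16"
    using resolvent_power_close[OF R r(1) less_imp_le[OF r(2)] close one, of n] by blast
  define u where "u = ((of_real r * 1) *\<^sub>C a) ^ (2 ^ n)"
  have u: "norm u < 1 / 32"
    using rn r(1) pow[of n] by (simp add: u_def scaleC_power norm_scaleC norm_power)
  have "x - 1 = x * u"
    using x unfolding inverses_def u_def[symmetric] by (simp add: algebra_simps)
  then have x1: "norm (x - 1) \<le> norm x * (1 / 32)"
    using norm_mult_ineq[of x u] u by (smt (verit) mult_left_mono norm_ge_zero)
  then have "norm x \<le> 2"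
    using norm_triangle_sub[of x 1] by simp
  then have "norm (x - 1) \<le> 1 / 16" using x1 by simp
  then have y1: "norm (y - 1) \<le> 1 / 8"
    using norm_triangle_ineq4[of "x - 1" "x - y"] xy by simp
  have "a ^ (2 ^ n) = (y - 1) * (1 - a ^ (2 ^ n))"
    using y by (simp add: inverses_def algebra_simps)
  then have "1 \<le> norm (y - 1) * norm (1 - a ^ (2 ^ n))"
    using pow[of n] norm_mult_ineq by metis
  also have "\<dots> \<le> (1 / 8) * 2"
    using y1 norm_triangle_ineq4[of 1 "a ^ (2 ^ n)"] pow[of n] by (intro mult_mono) simp_all
  finally show False by simp
qed

text \<open>After scaling to norm 1, the C*-identity keeps the powers with exponent
  \<open>2^k\<close> at norm 1, so some \<open>1 - z b\<close> with \<open>cmod z <= 1\<close> is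
  singular. Then \<open>w = norm a / z\<close> is a spectral value of modulus at least
  \<open>norm a\<close>, and it is real because \<open>a\<close> is self-adjoint.\<close>

theorem selfadjoint_spectral_radius:
  fixes a :: "'b::{cstar_algebra, real_normed_algebra_1}"
  assumes a: "adj a = a" and "a \<noteq> 0"
  shows "\<exists>s. norm a \<le> \<bar>s\<bar> \<and> \<not> invertible_element (a - s *\<^sub>R 1)"
proof -
  define m where "m = norm a"
  have m: "m > 0" using assms by (simp add: m_def)
  define b where "b = (1 / m) *\<^sub>R a"
  have "adj b = b" by (simp add: b_def adj_scaleR a)
  have "adj (b ^ n) = b ^ n" for n
    by (induction n) (simp_all add: adj_mult \<open>adj b = b\<close> power_commutes)
  then have "norm (b ^ (2 ^ k)) = 1" for k
  proof (induction k)
    case (Suc k)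
    have "b ^ (2 ^ Suc k) = adj (b ^ (2 ^ k)) * b ^ (2 ^ k)"
      by (simp add: Suc.prems mult_2 flip: power_add)
    then show ?case using Suc cstar_identity by (metis power_one)
  qed (use m in \<open>simp add: b_def m_def\<close>)
  then obtain z where z: "cmod z \<le> 1" "\<not> invertible_element (1 - z *\<^sub>C b)"
    using unit_norm_resolvent by blast
  have "z \<noteq> 0" using z(2) by auto
  define w where "w = of_real m / z"
  have w0: "w \<noteq> 0" using m \<open>z \<noteq> 0\<close> by (simp add: w_def)
  have "(- w) *\<^sub>C (1 - z *\<^sub>C b) = a - w *\<^sub>C 1"
    using m \<open>z \<noteq> 0\<close> by (simp add: scaleC_diff_right scaleC_minus_left b_def scaleC_scaleC w_def
      flip: scaleC_of_real)
  then have ni: "\<not> invertible_element (a - w *\<^sub>C 1)"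
    using z(2) w0 invertible_element_scaleC_iff[of "- w" "1 - z *\<^sub>C b"] by simp
  then have "Im w = 0" using selfadjoint_nonreal_invertible[OF a] by blast
  then have w: "w = of_real (Re w)" by (simp add: complex_eq_iff)
  have "cmod w \<ge> m" using z(1) \<open>z \<noteq> 0\<close> m by (simp add: w_def norm_divide field_simps)
  then have "m \<le> \<bar>Re w\<bar>" using w by (metis norm_of_real)
  moreover have "\<not> invertible_element (a - Re w *\<^sub>R 1)"
    using ni w by (metis scaleC_of_real)
  ultimately show ?thesis unfolding m_def by blast
qed

subsection \<open>Comparing positive elements\<close>

text \<open>With \<open>b = 1 - s\<close> the equation \<open>b * b = 1 - d\<close> becomes
  \<open>s = (d + s * s) / 2\<close>, whose right side is a contraction with constant
  \<open>norm d\<close> on the self-adjoint elements of norm at most \<open>norm d\<close>.\<close>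

lemma selfadjoint_square_root_near_one:
  fixes d :: "'b::{cstar_algebra, real_normed_algebra_1}"
  assumes d: "adj d = d" "norm d < 1"
  obtains b where "adj b = b" "b * b = 1 - d"
proof -
  define S where "S = {s :: 'b. adj s = s \<and> norm s \<le> norm d}"
  define f where "f s = (1 / 2) *\<^sub>R (d + s * s)" for s :: 'b
  have "closed S"
    unfolding S_def Collect_conj_eq using linear_continuous_on[OF bounded_linear_adj]
    by (intro closed_Int closed_Collect_eq closed_Collect_le continuous_intros) auto
  then have "complete S" by (simp add: complete_eq_closed)
  moreover have "S \<noteq> {}" by (auto simp: S_def intro: exI[of _ 0])
  moreover have "f ` S \<subseteq> S"
  proof
    fix t assume "t \<in> f ` S"
    then obtain s where s: "adj s = s" "norm s \<le> norm d" "t = f s" by (auto simp: S_def)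
    have "norm (s * s) \<le> norm d * 1"
      using norm_mult_ineq[of s s] mult_mono[of "norm s" "norm d" "norm s" 1] s d by simp
    then have "norm t \<le> norm d"
      using norm_triangle_ineq[of d "s * s"] by (simp add: s f_def)
    then show "t \<in> S" by (simp add: S_def s f_def adj_scaleR adj_add adj_mult d)
  qed
  moreover have "dist (f s) (f t) \<le> norm d * dist s t" if "s \<in> S" "t \<in> S" for s t
  proof -
    have "f s - f t = (1 / 2) *\<^sub>R (s * (s - t) + (s - t) * t)"
      by (simp add: f_def algebra_simps)
    then have "norm (f s - f t) \<le> (1 / 2) * (norm (s * (s - t)) + norm ((s - t) * t))"
      using norm_triangle_ineq[of "s * (s - t)" "(s - t) * t"] by simp
    also have "\<dots> \<le> (1 / 2) * (norm s * norm (s - t) + norm (s - t) * norm t)"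
      by (intro mult_left_mono add_mono norm_mult_ineq) simp
    also have "\<dots> \<le> (1 / 2) * (norm d * norm (s - t) + norm (s - t) * norm d)"
      using that by (intro mult_left_mono add_mono mult_right_mono) (simp_all add: S_def)
    finally show ?thesis by (simp add: dist_norm mult.commute)
  qed
  ultimately obtain s where s: "s \<in> S" "f s = s"
    using Banach_fix[of S "norm d" f] d(2) by auto
  have "2 *\<^sub>R f s = 2 *\<^sub>R s" using s by simp
  then have "d + s * s = s + s" by (simp add: f_def scaleR_2)
  then have "(1 - s) * (1 - s) = 1 - d" by (simp add: algebra_simps)
  moreover have "adj (1 - s) = 1 - s" using s by (simp add: S_def adj_diff)
  ultimately show ?thesis using that by blast
qed

text \<open>Here b is the square root of e / (q + e).\<close>
lemma normalizing_root:
  fixes q :: "'b::{cstar_algebra, real_normed_algebra_1}"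
  assumes q: "adj q = q" "\<And>s. s < 0 \<Longrightarrow> invertible_element (q - s *\<^sub>R 1)" and e: "e > 0"
  obtains b where "adj b = b" "invertible_element b" "norm (1 - b * b) < 1"
    "b * q * b = e *\<^sub>R (1 - b * b)"
proof -
  have "invertible_element (q + e *\<^sub>R 1)" using q(2)[of "- e"] e by simp
  then obtain c where c: "inverses (q + e *\<^sub>R 1) c" unfolding invertible_element_def by blast
  then have ic: "invertible_element c" unfolding invertible_element_def inverses_def by blast
  have "inverses (q + e *\<^sub>R 1) (adj c)"
  proof -
    have "adj (q + e *\<^sub>R 1) = q + e *\<^sub>R 1" by (simp add: adj_add adj_scaleR q)
    then show ?thesis using c unfolding inverses_def by (metis adj_mult adj_one)
  qed
  then have adjc: "adj c = c"
    using c unfolding inverses_def by (metis mult.assoc mult_1_left mult_1_right)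
  \<comment> \<open>This is \<open>q / (q + e)\<close>. Its spectrum should lie in the interval from
    0 to 1 with 1 excluded, which forces \<open>norm d < 1\<close>.\<close>
  define d where "d = 1 - e *\<^sub>R c"
  have adjd: "adj d = d" by (simp add: d_def adj_diff adj_scaleR adjc)
  have "norm d < 1"
  proof (cases "d = 0")
    case False
    then obtain s where s: "norm d \<le> \<bar>s\<bar>" "\<not> invertible_element (d - s *\<^sub>R 1)"
      using selfadjoint_spectral_radius[OF adjd] by blast
    have "s \<noteq> 1"
    proof
      assume "s = 1"
      then have "d - s *\<^sub>R 1 = complex_of_real (- e) *\<^sub>C c"
        by (simp only: scaleC_of_real) (simp add: d_def)
      then show False using s(2) e ic invertible_element_scaleC[of c "complex_of_real (- e)"] by simp
    qed
    \<comment> \<open>Solves \<open>s = t / (t + e)\<close>, so a spectral value \<open>s\<close> of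
      \<open>d\<close> comes from the spectral value \<open>t\<close> of \<open>q\<close>.\<close>
    define t where "t = s * e / (1 - s)"
    have t: "(1 - s) * t = s * e" using \<open>s \<noteq> 1\<close> by (simp add: t_def)
    have "d - s *\<^sub>R 1 = complex_of_real (1 - s) *\<^sub>C ((q - t *\<^sub>R 1) * c)"
    proof -
      have "(1 - s) *\<^sub>R ((q - t *\<^sub>R 1) * c) = (1 - s) *\<^sub>R ((q + e *\<^sub>R 1) * c) - ((1 - s) * e) *\<^sub>R c - ((1 - s) * t) *\<^sub>R c"
        by (simp add: algebra_simps)
      also have "\<dots> = d - s *\<^sub>R 1"
        using c unfolding inverses_def t d_def by (simp add: algebra_simps)
      finally show ?thesis by (simp only: scaleC_of_real)
    qed
    then have "\<not> invertible_element (q - t *\<^sub>R 1)"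
      using s(2) ic \<open>s \<noteq> 1\<close> invertible_element_scaleC[of _ "complex_of_real (1 - s)"]
        invertible_element_mult by (metis eq_iff_diff_eq_0 of_real_eq_0_iff)
    then have "t \<ge> 0" using q(2)[of t] by linarith
    moreover have "t = e * (s / (1 - s))" by (simp add: t_def)
    ultimately have "s / (1 - s) \<ge> 0" using e by (metis not_less zero_le_mult_iff)
    then have "0 \<le> s" "s < 1" using \<open>s \<noteq> 1\<close> by (auto simp: zero_le_divide_iff)
    then show ?thesis using s(1) by simp
  qed simp
  then obtain b where b: "adj b = b" "b * b = 1 - d"
    using selfadjoint_square_root_near_one[OF adjd] by blast
  have bb: "b * b = e *\<^sub>R c" using b by (simp add: d_def)
  have "invertible_element (b * b)"
    unfolding bb using invertible_element_scaleC[OF ic, of "complex_of_real e"] e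
    by (simp add: scaleC_of_real)
  then have ib: "invertible_element b" by (rule invertible_element_of_square)
  then obtain b' where b': "b * b' = 1" unfolding invertible_element_def inverses_def by blast
  \<comment> \<open>Multiplying by one more \<open>b\<close> brings in \<open>b * b = e c\<close>,
    and cancelling it afterwards sidesteps the question whether \<open>b\<close> commutes with
    \<open>q\<close>.\<close>
  have "b * (q + e *\<^sub>R 1) * b * b = b * ((q + e *\<^sub>R 1) * (b * b))" by (simp add: mult.assoc)
  also have "\<dots> = e *\<^sub>R b"
    using c unfolding bb inverses_def by simp
  finally have "b * (q + e *\<^sub>R 1) * b * b * b' = e *\<^sub>R b * b'" by simp
  then have "b * (q + e *\<^sub>R 1) * b = e *\<^sub>R 1" by (simp add: mult.assoc b')
  then have "b * q * b = e *\<^sub>R (1 - b * b)" by (simp add: algebra_simps)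
  moreover have "norm (1 - b * b) < 1" using b(2) \<open>norm d < 1\<close> by simp
  ultimately show ?thesis using that b(1) ib by blast
qed

text \<open>Norm domination of \<open>p\<close> by \<open>q\<close> under all self-adjoint
  congruences keeps positive numbers out of the spectrum of \<open>p - q\<close>; the test element
  is the normalizing root for \<open>e\<close>.\<close>

lemma invertible_shifted_difference:
  fixes p q :: "'b::{cstar_algebra, real_normed_algebra_1}"
  assumes q: "adj q = q" "\<And>s. s < 0 \<Longrightarrow> invertible_element (q - s *\<^sub>R 1)" and e: "e > 0"
    and norm_le: "\<And>b. adj b = b \<Longrightarrow> norm (b * p * b) \<le> norm (b * q * b)"
  shows "invertible_element (p - q - e *\<^sub>R 1)"
proof -
  obtain b where b: "adj b = b" "invertible_element b" "norm (1 - b * b) < 1"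
    "b * q * b = e *\<^sub>R (1 - b * b)"
    by (rule normalizing_root[OF q e])
  have "norm (b * p * b) < cmod (complex_of_real e)"
    using norm_le[OF b(1)] b(3,4) e by (simp add: order_le_less_trans)
  then have "invertible_element (b * p * b - complex_of_real e *\<^sub>C 1)"
    by (rule invertible_scalar_minus)
  moreover have "b * p * b - complex_of_real e *\<^sub>C 1 = b * (p - q - e *\<^sub>R 1) * b"
  proof -
    have "b * (p - q - e *\<^sub>R 1) * b = b * p * b - b * q * b - e *\<^sub>R (b * b)"
      by (simp add: algebra_simps)
    then show ?thesis unfolding b(4) by (simp add: scaleC_of_real scaleR_diff_right)
  qed
  ultimately show ?thesis using invertible_element_of_mult[OF b(2)] by simp
qed

text \<open>Exchanging \<open>p\<close> and \<open>q\<close> in the previous lemma excludes negative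
  spectral values too, while a non-zero self-adjoint \<open>p - q\<close> must have a non-zero
  one.\<close>

lemma positive_eqI_norm_congruence:
  fixes p q :: "'b::{cstar_algebra, real_normed_algebra_1}"
  assumes p: "adj p = p" "\<And>s. s < 0 \<Longrightarrow> invertible_element (p - s *\<^sub>R 1)"
    and q: "adj q = q" "\<And>s. s < 0 \<Longrightarrow> invertible_element (q - s *\<^sub>R 1)"
    and eq: "\<And>b. adj b = b \<Longrightarrow> norm (b * p * b) = norm (b * q * b)"
  shows "p = q"
proof (rule ccontr)
  assume "p \<noteq> q"
  then obtain s where s: "norm (p - q) \<le> \<bar>s\<bar>" "\<not> invertible_element (p - q - s *\<^sub>R 1)"
    using selfadjoint_spectral_radius[of "p - q"] by (auto simp: adj_diff p q)
  have "s \<noteq> 0" using s(1) \<open>p \<noteq> q\<close> by auto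
  moreover have "\<not> s > 0"
    using invertible_shifted_difference[OF q, of s p] eq s(2) by auto
  moreover have "\<not> s < 0"
  proof
    assume "s < 0"
    then have "invertible_element (q - p - (- s) *\<^sub>R 1)"
      using invertible_shifted_difference[OF p, of "- s" q] eq by auto
    then have "invertible_element ((- 1) *\<^sub>C (q - p - (- s) *\<^sub>R 1))"
      by (intro invertible_element_scaleC) simp_all
    then show False using s(2) by (simp add: scaleC_minus_left algebra_simps)
  qed
  ultimately show False by linarith
qed

subsection \<open>Hilbert modules\<close>

text \<open>Links the pairs in the definition of \<open>spectrum\<close> to the ring structure on
  \<open>unitization\<close>.\<close>

lemma unitization_invertible_iff:
  "unitization_invertible (a, s) \<longleftrightarrow> invertible_element (Unitization a s)"
proof -
  have "(\<exists>v. unitization_mult (a, s) v = (0, 1) \<and> unitization_mult v (a, s) = (0, 1)) \<longleftrightarrow>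
    (\<exists>v. inverses (Unitization a s) v)"
  proof
    assume "\<exists>v. unitization_mult (a, s) v = (0, 1) \<and> unitization_mult v (a, s) = (0, 1)"
    then obtain b t where "unitization_mult (a, s) (b, t) = (0, 1)" "unitization_mult (b, t) (a, s) = (0, 1)"
      by auto
    then show "\<exists>v. inverses (Unitization a s) v"
      by (intro exI[of _ "Unitization b t"])
        (simp add: inverses_def times_unitization_def one_unitization_def)
  next
    assume "\<exists>v. inverses (Unitization a s) v"
    then obtain v where "inverses (Unitization a s) v" by blast
    then show "\<exists>v. unitization_mult (a, s) v = (0, 1) \<and> unitization_mult v (a, s) = (0, 1)"
      by (intro exI[of _ "(alg_part v, scalar_part v)"])
        (simp add: inverses_def times_unitization_def one_unitization_def)
  qed
  then show ?thesis by (simp add: unitization_invertible_def invertible_element_def)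
qed

lemma adj_embed: "adj (embed a) = embed (adj a)"
  by (simp add: adj_unitization_def)

lemma positive_embed_invertible:
  assumes "positive a" "s < 0"
  shows "invertible_element (embed a - s *\<^sub>R 1)"
proof -
  have "complex_of_real s \<notin> spectrum a"
    using assms unfolding positive_def by auto
  then have "invertible_element (Unitization a (- complex_of_real s))"
    by (simp add: spectrum_def unitization_invertible_iff)
  then show ?thesis
    by (simp add: minus_unitization_def scaleR_unitization_def one_unitization_def scaleR_conv_of_real)
qed

context hilbert_module
begin

section \<open>Inner products, the action of the unitization, and isometric operators\<close>

lemma ip_add_right: "ip x (y + z) = ip x y + ip x z"
  by (metis adj_add ip_add_left ip_adj)

lemma ip_scaleC_right: "ip x (c *\<^sub>C y) = cnj c *\<^sub>C ip x y"
  by (metis adj_scaleC ip_adj ip_scaleC_left)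

lemma ip_act_right: "ip x (act a y) = ip x y * adj a"
  by (metis adj_mult ip_adj ip_act_left)

lemma ip_scaleR_left: "ip (r *\<^sub>R x) y = r *\<^sub>R ip x y"
  by (metis ip_scaleC_left scaleC_of_real)

lemma ip_scaleR_right: "ip x (r *\<^sub>R y) = r *\<^sub>R ip x y"
  by (metis complex_cnj_complex_of_real ip_scaleC_right scaleC_of_real)

lemma act_scaleR: "act a (r *\<^sub>R x) = r *\<^sub>R act a x"
  by (metis act_scaleC_right scaleC_of_real)

lemma norm_power2_eq_norm_ip: "(norm x)\<^sup>2 = norm (ip x x)"
  using norm_eq_sqrt_ip[of x] by simp

definition unitization_act :: "'a unitization \<Rightarrow> 'm \<Rightarrow> 'm" where
  "unitization_act u x = act (alg_part u) x + scalar_part u *\<^sub>C x"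

text \<open>For self-adjoint \<open>u\<close> and \<open>x = y\<close> this interprets the norm of
  the congruence \<open>u p u\<close> of \<open>p = (x, x)\<close> as the square of the norm of a
  module vector.\<close>

lemma embed_ip_unitization_act:
  "embed (ip (unitization_act u x) (unitization_act u y)) = u * embed (ip x y) * adj u"
  by (simp add: unitization_act_def ip_add_left ip_add_right ip_act_left ip_act_right
    ip_scaleC_left ip_scaleC_right times_unitization_def adj_unitization_def algebra_simps
    scaleC_add_right scaleC_scaleC scaleC_mult_left scaleC_mult_right)

text \<open>\<open>U\<close> commutes with the action of the unitization, so
  \<open>norm (b U x) = norm (U (b x)) = norm (b x)\<close>; the squares of these norms are the
  norms of the congruences by \<open>b\<close>.\<close>

lemma isometric_module_operator_ip_diag:
  assumes "isometric_module_operator act U"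
  shows "ip (U x) (U x) = ip x x"
proof -
  have map: "module_map act U" and iso: "\<And>x. norm (U x) = norm x"
    using assms unfolding isometric_module_operator_def by auto
  have U: "U (unitization_act u x) = unitization_act u (U x)" for u
    using map unfolding module_map_def by (simp add: unitization_act_def)
  have "embed (ip (U x) (U x)) = embed (ip x x)"
  proof (rule positive_eqI_norm_congruence)
    fix b :: "'a unitization"
    assume b: "adj b = b"
    have nb: "norm (b * embed (ip y y) * b) = (norm (unitization_act b y))\<^sup>2" for y
      using embed_ip_unitization_act[of b y y] b by (metis norm_embed norm_power2_eq_norm_ip)
    show "norm (b * embed (ip (U x) (U x)) * b) = norm (b * embed (ip x x) * b)"
      unfolding nb U[symmetric] iso ..
  qed (simp_all add: adj_embed positive_embed_invertible ip_positive flip: ip_adj)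
  then show ?thesis by simp
qed

lemma isometric_module_operator_ip:
  assumes "isometric_module_operator act U"
  shows "ip (U x) (U y) = ip x y"
proof -
  have U: "U (x + c *\<^sub>C y) = U x + c *\<^sub>C U y" for c
    using assms unfolding isometric_module_operator_def module_map_def by metis
  note diag = isometric_module_operator_ip_diag[OF assms]
  \<comment> \<open>For \<open>c\<close> of modulus 1 the diagonal terms of both expansions agree
    and cancel.\<close>
  have eq: "cnj c *\<^sub>C ip (U x) (U y) + c *\<^sub>C ip (U y) (U x) = cnj c *\<^sub>C ip x y + c *\<^sub>C ip y x"
    if "c * cnj c = 1" for c
    using diag[of "x + c *\<^sub>C y"] that
    by (simp add: U ip_add_left ip_add_right ip_scaleC_left ip_scaleC_right scaleC_add_right
      scaleC_scaleC diag mult.commute algebra_simps)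
  have 1: "ip (U x) (U y) + ip (U y) (U x) = ip x y + ip y x"
    using eq[of 1] by simp
  \<comment> \<open>Multiplying the case \<open>c = \<i>\<close> by \<open>\<i>\<close> gives the
    cross terms the coefficients 1 and -1.\<close>
  have "\<i> *\<^sub>C (cnj \<i> *\<^sub>C ip (U x) (U y) + \<i> *\<^sub>C ip (U y) (U x)) = \<i> *\<^sub>C (cnj \<i> *\<^sub>C ip x y + \<i> *\<^sub>C ip y x)"
    using eq[of \<i>] by simp
  then have 2: "ip (U x) (U y) - ip (U y) (U x) = ip x y - ip y x"
    unfolding scaleC_add_right scaleC_scaleC by (simp add: scaleC_minus_left)
  have "ip (U x) (U y) + ip (U x) (U y) = ip x y + ip x y"
    using arg_cong2[OF 1 2, of "(+)"] by simp
  then have "2 *\<^sub>R ip (U x) (U y) = 2 *\<^sub>R ip x y" by (simp add: scaleR_2)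
  then show ?thesis by simp
qed

section \<open>Conformal maps scale all norms by one factor\<close>

lemma ip_nondegenerate: "(\<And>z. ip x z = 0) \<Longrightarrow> x = 0"
  using ip_eq_zero_iff by blast

lemma module_map_scaleR:
  assumes "module_map act T"
  shows "T (r *\<^sub>R x) = r *\<^sub>R T x"
  using assms unfolding module_map_def by (metis scaleC_of_real)

lemma cstar_conformal_norm_ratio:
  assumes T: "cstar_conformal act ip T" and x: "x \<noteq> 0" and y: "y \<noteq> 0"
  shows "norm (T x) / norm x = norm (T y) / norm y"
\<comment> \<open>Only real multiples are split off: the coefficients of the dependence found below
  are real, so a non-real multiple of \<open>x\<close> can be treated as independent.\<close>
proof (cases "\<exists>r. y = r *\<^sub>R x")
  case True
  then obtain r where r: "y = r *\<^sub>R x" by blast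
  have "T y = r *\<^sub>R T x"
    using T unfolding r cstar_conformal_def bounded_module_map_def by (simp add: module_map_scaleR)
  then show ?thesis using r y by simp
next
  case False
  have map: "module_map act T" and inj: "inj T"
    using T unfolding cstar_conformal_def bounded_module_map_def by auto
  have add: "T (u + v) = T u + T v" for u v using map unfolding module_map_def by blast
  have T0: "T z = 0 \<longleftrightarrow> z = 0" for z
    using inj module_map_scaleR[OF map, of 0 0] by (metis injD scaleR_zero_left)
  define f where "f z = norm (T z) / norm z" for z
  have f: "f z \<noteq> 0" if "z \<noteq> 0" for z using that by (simp add: f_def T0)
  have conf: "ip (T u) (T v) = (f u * f v) *\<^sub>R ip u v" if "u \<noteq> 0" "v \<noteq> 0" for u v
  proof -
    have "(norm (T u) * norm (T v)) *\<^sub>R (ip (T u) (T v) /\<^sub>R (norm (T u) * norm (T v)))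
        = (norm (T u) * norm (T v)) *\<^sub>R (ip u v /\<^sub>R (norm u * norm v))"
      using T that unfolding cstar_conformal_def by simp
    then show ?thesis using that by (simp add: T0 f_def divide_inverse mult.commute mult.left_commute)
  qed
  have xy: "x + y \<noteq> 0"
    using False by (metis add.commute add_eq_0_iff scaleR_minus1_left)
  \<comment> \<open>Pairing \<open>T (x + y) = T x + T y\<close> with \<open>T z\<close> and
    cancelling \<open>f z\<close> shows that this vector is orthogonal to every
    \<open>z\<close>.\<close>
  define u where "u = (f (x + y) - f x) *\<^sub>R x + (f (x + y) - f y) *\<^sub>R y"
  have "u = 0"
  proof (rule ip_nondegenerate)
    fix z
    show "ip u z = 0"
    proof (cases "z = 0")
      case True
      then show ?thesis using ip_scaleR_right[of u 0 0] by simp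
    next
      case False
      have "(f (x + y) * f z) *\<^sub>R ip (x + y) z = (f x * f z) *\<^sub>R ip x z + (f y * f z) *\<^sub>R ip y z"
        using conf[OF xy False] conf[OF x False] conf[OF y False] by (simp add: add ip_add_left)
      then have "f z *\<^sub>R ip u z = 0"
        unfolding u_def ip_add_left ip_scaleR_left by (simp add: algebra_simps)
      then show ?thesis using f[OF False] by simp
    qed
  qed
  then have dep: "(f (x + y) - f y) *\<^sub>R y = (f x - f (x + y)) *\<^sub>R x"
    by (simp add: u_def algebra_simps)
  have "f (x + y) = f y"
  proof (rule ccontr)
    assume "f (x + y) \<noteq> f y"
    then have "y = ((f x - f (x + y)) / (f (x + y) - f y)) *\<^sub>R x"
      using arg_cong[OF dep, of "\<lambda>v. (1 / (f (x + y) - f y)) *\<^sub>R v"] by simp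
    then show False using False by blast
  qed
  moreover from this dep have "f x = f (x + y)" using x by simp
  ultimately show ?thesis by (simp add: f_def)
qed

end

section \<open>Conformality and positive multiples of isometries\<close>

theorem theorem2p1:
  fixes act :: "'a::cstar_algebra \<Rightarrow> 'm::complex_banach \<Rightarrow> 'm"
    and ip :: "'m \<Rightarrow> 'm \<Rightarrow> 'a"
    and T :: "'m \<Rightarrow> 'm"
  assumes "hilbert_module act ip"
    and "bounded_module_map act T"
    and "inj T"
  shows "cstar_conformal act ip T \<longleftrightarrow>
    (\<exists>(l::real) U. l > 0 \<and> isometric_module_operator act U \<and> T = (\<lambda>x. l *\<^sub>R U x))"
proof
  interpret hilbert_module act ip by fact
  have map: "module_map act T" using assms(2) unfolding bounded_module_map_def by blast
  have T0: "T z = 0 \<longleftrightarrow> z = 0" for z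
    using \<open>inj T\<close> module_map_scaleR[OF map, of 0 0] by (metis injD scaleR_zero_left)
  {
    assume conf: "cstar_conformal act ip T"
    obtain l where l: "l > 0" "\<And>x. norm (T x) = l * norm x"
    proof (cases "\<exists>x::'m. x \<noteq> 0")
      case True
      then obtain x :: 'm where x: "x \<noteq> 0" by blast
      have "norm (T y) = norm (T x) / norm x * norm y" for y
        using cstar_conformal_norm_ratio[OF conf x, of y] T0[of y] by (cases "y = 0") simp_all
      moreover have "norm (T x) / norm x > 0" using x by (simp add: T0)
      ultimately show ?thesis using that by blast
    next
      case False
      \<comment> \<open>In the zero module every factor works; 1 is chosen.\<close>
      then show ?thesis using that[of 1] by (metis T0 norm_zero mult_zero_right zero_less_one)
    qed
    have "isometric_module_operator act (\<lambda>x. (1 / l) *\<^sub>R T x)"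
      using map l unfolding isometric_module_operator_def module_map_def
      by (simp add: scaleR_add_right scaleC_scaleR act_scaleR)
    moreover have "T = (\<lambda>x. l *\<^sub>R ((1 / l) *\<^sub>R T x))" using l by simp
    ultimately show "\<exists>l U. l > 0 \<and> isometric_module_operator act U \<and> T = (\<lambda>x. l *\<^sub>R U x)"
      using l(1) by (intro exI[of _ l] exI[of _ "\<lambda>x. (1 / l) *\<^sub>R T x"] conjI)
  }
  {
    assume "\<exists>l U. l > 0 \<and> isometric_module_operator act U \<and> T = (\<lambda>x. l *\<^sub>R U x)"
    then obtain l U where l: "l > 0" and U: "isometric_module_operator act U"
      and T: "T = (\<lambda>x. l *\<^sub>R U x)" by blast
    \<comment> \<open>The factor \<open>l^2\<close> cancels. Zero vectors are covered too, since
      \<open>inverse 0 = 0\<close> makes both sides vanish.\<close>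
    have "ip (T x) (T y) /\<^sub>R (norm (T x) * norm (T y)) = ip x y /\<^sub>R (norm x * norm y)" for x y
    proof -
      have "norm (U x) = norm x" "norm (U y) = norm y"
        using U unfolding isometric_module_operator_def by auto
      then show ?thesis
        using l by (simp add: T ip_scaleR_left ip_scaleR_right isometric_module_operator_ip[OF U]
            divide_simps)
    qed
    then show "cstar_conformal act ip T"
      using assms unfolding cstar_conformal_def by blast
  }
qed

end
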